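(* Let $\gamma=(1-\beta^2)^{-\frac12}$ be the Lorentz factor, and let $\mu=3\gamma^3\xi$ be a given (fixed) non-zero real number, i.e. $\xi=\mu/(3\gamma^3)$. Then in the ultra-relativistic limit $\gamma\to+\infty$ (i.e. $\beta\to1^-$) one has the asymptotic expansion $$V^{\mathrm S}(\xi)=\gamma K^{\mathrm{fs}}(\mu)+\begin{cases}O(\gamma^{-1})&\text{for }\mu>0,\\ O(\gamma^{-3})&\text{for }\mu<0,\end{cases}$$ with $$K^{\mathrm{fs}}(\mu)=\begin{cases}2\,\dfrac{\cosh\left[\frac53\sinh^{-1}\mu\right]-\cosh\left[\sinh^{-1}\mu\right]}{\sinh\left[2\sinh^{-1}\mu\right]}&\text{if }\mu>0,\\[1em] 0&\text{if }\mu<0.\end{cases}$$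
   Context: Here $\beta\in(0,1)$ is the velocity of the particle relative to the speed of light. For non-zero $\xi\in(-\pi,\pi)$, the angle $\alpha\in(-\pi,\pi)$ is determined by $\xi=\alpha-\beta|\sin\alpha|$. The synchrotron part of the potential is $$V^{\mathrm S}(\xi)=\frac{(1-\beta^2)\left(|\sin\xi|-|\sin\alpha|+\beta\sin\alpha\cos\alpha\right)+2\beta^2\sin^2\alpha\,|\sin\xi|}{2|\sin\xi|\left(|\sin\alpha|-\beta\sin\alpha\cos\alpha\right)} .$$ Here $\sinh^{-1}$ is the inverse hyperbolic sine. *)

theory Defs
  imports Complex_Main "HOL-Library.Landau_Symbols"
begin

definition lorentz :: "real \<Rightarrow> real" where
  "lorentz \<beta> = (1 - \<beta>\<^sup>2) powr (- 1 / 2)"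

definition alpha :: "real \<Rightarrow> real \<Rightarrow> real" where
  "alpha \<beta> \<xi> = (THE \<alpha>. - pi < \<alpha> \<and> \<alpha> < pi \<and> \<xi> = \<alpha> - \<beta> * \<bar>sin \<alpha>\<bar>)"

text \<open>The description in \<open>alpha\<close> is proper in the range of parameters that matters.\<close>

lemma alpha_ex1:
  fixes \<beta> \<xi> :: real
  assumes "0 < \<beta>" "\<beta> < 1" "- pi < \<xi>" "\<xi> < pi"
  shows "\<exists>!\<alpha>. - pi < \<alpha> \<and> \<alpha> < pi \<and> \<xi> = \<alpha> - \<beta> * \<bar>sin \<alpha>\<bar>"
proof -
  have lip: "\<bar>\<bar>sin x\<bar> - \<bar>sin y\<bar>\<bar> \<le> \<bar>x - y\<bar>" for x y :: real
  proof -
    have "\<bar>sin x - sin y\<bar> = 2 * (\<bar>sin ((x - y) / 2)\<bar> * \<bar>cos ((x + y) / 2)\<bar>)"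
      by (simp add: sin_diff_sin abs_mult)
    also have "\<dots> \<le> 2 * (\<bar>(x - y) / 2\<bar> * 1)"
      by (intro mult_left_mono mult_mono abs_sin_x_le_abs_x) auto
    finally have "\<bar>sin x - sin y\<bar> \<le> \<bar>x - y\<bar>" by simp
    then show ?thesis using abs_triangle_ineq3 [of "sin x" "sin y"] by linarith
  qed
  have inj: "x = y" if "x - \<beta> * \<bar>sin x\<bar> = y - \<beta> * \<bar>sin y\<bar>" for x y
  proof (rule ccontr)
    assume "x \<noteq> y"
    have "\<bar>x - y\<bar> = \<beta> * \<bar>\<bar>sin x\<bar> - \<bar>sin y\<bar>\<bar>"
    proof -
      have "x - y = \<beta> * (\<bar>sin x\<bar> - \<bar>sin y\<bar>)"
        using that by (simp add: algebra_simps)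
      then show ?thesis using assms(1) by (simp add: abs_mult)
    qed
    also have "\<dots> \<le> \<beta> * \<bar>x - y\<bar>"
      using lip assms(1) by (simp add: mult_left_mono)
    also have "\<dots> < \<bar>x - y\<bar>" using assms(2) \<open>x \<noteq> y\<close> by simp
    finally show False by simp
  qed
  have "\<exists>x\<ge>- pi. x \<le> pi \<and> x - \<beta> * \<bar>sin x\<bar> = \<xi>"
    by (rule IVT') (use assms in \<open>auto intro!: continuous_intros\<close>)
  then obtain x where x: "- pi \<le> x" "x \<le> pi" "x - \<beta> * \<bar>sin x\<bar> = \<xi>" by blast
  have "x \<noteq> pi" "x \<noteq> - pi" using x(3) assms by auto
  then have "- pi < x \<and> x < pi \<and> \<xi> = x - \<beta> * \<bar>sin x\<bar>"
    using x by auto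
  then show ?thesis using inj by (metis (no_types, lifting))
qed

definition V_S :: "real \<Rightarrow> real \<Rightarrow> real" where
  "V_S \<beta> \<xi> = (let \<alpha> = alpha \<beta> \<xi> in
     ((1 - \<beta>\<^sup>2) * (\<bar>sin \<xi>\<bar> - \<bar>sin \<alpha>\<bar> + \<beta> * sin \<alpha> * cos \<alpha>)
        + 2 * \<beta>\<^sup>2 * (sin \<alpha>)\<^sup>2 * \<bar>sin \<xi>\<bar>)
     / (2 * \<bar>sin \<xi>\<bar> * (\<bar>sin \<alpha>\<bar> - \<beta> * sin \<alpha> * cos \<alpha>)))"

text \<open>The value at \<open>\<mu> = 0\<close> is a dummy.\<close>

definition K_fs :: "real \<Rightarrow> real" where
  "K_fs \<mu> = (if \<mu> > 0
     then 2 * ((cosh (5 / 3 * arsinh \<mu>) - cosh (arsinh \<mu>)) / sinh (2 * arsinh \<mu>))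
     else 0)"

end

theory Submission
  imports Defs "HOL-Real_Asymp.Real_Asymp"
begin

text \<open>
  Put \<open>\<epsilon> = 1 / \<gamma>\<close>, so that \<open>1 - \<beta> = \<epsilon>^2 / 2 + O(\<epsilon>^4)\<close>. For \<open>\<mu> > 0\<close> the rescaled angle
  \<open>A = \<alpha> / \<epsilon>\<close> is bounded, and expanding the sine in the equation for \<open>\<alpha>\<close> gives
  \<open>A / 2 + A^3 / 6 = \<mu> / 3 + O(\<epsilon>^2)\<close>. Since the cubic increases with slope at least \<open>1 / 2\<close>,
  \<open>A = a + O(\<epsilon>^2)\<close> with \<open>3 a + a^3 = 2 \<mu>\<close>, that is, \<open>a = 2 sinh (arsinh \<mu> / 3)\<close>. The numerator of
  the potential is of order \<open>\<epsilon>^5\<close> and the denominator of order \<open>\<epsilon>^6\<close>, both with relative error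
  \<open>O(\<epsilon>^2)\<close>. For \<open>\<mu> < 0\<close> the angle is of order \<open>\<epsilon>^3\<close> instead; the equation for \<open>\<alpha>\<close> cancels the
  linear terms of the numerator, leaving \<open>O(\<epsilon>^9)\<close> over \<open>\<epsilon>^6\<close>.
\<close>

section \<open>Arithmetic of approximations \<open>f = c + O(g)\<close>\<close>

lemma bigo_approx_add:
  fixes f f' g :: "'a \<Rightarrow> real"
  assumes "(\<lambda>x. f x - c) \<in> O[F](g)" "(\<lambda>x. f' x - c') \<in> O[F](g)"
  shows "(\<lambda>x. (f x + f' x) - (c + c')) \<in> O[F](g)"
  using sum_in_bigo(1)[OF assms] by (simp add: algebra_simps)

text \<open>Expand f f' - c c' = (f - c) (f' - c') + c (f' - c') + c' (f - c). The product of the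
  two errors is again O(g), because g tends to 0 and is therefore bounded.\<close>

lemma bigo_approx_mult:
  fixes f f' g :: "'a \<Rightarrow> real"
  assumes f: "(\<lambda>x. f x - c) \<in> O[F](g)" and f': "(\<lambda>x. f' x - c') \<in> O[F](g)"
    and g: "(g \<longlongrightarrow> 0) F"
  shows "(\<lambda>x. (f x * f' x) - (c * c')) \<in> O[F](g)"
proof -
  have "g \<in> O[F](\<lambda>_. 1)"
    by (rule bigoI_tendsto[of _ _ 0]) (use g in simp_all)
  then have "(\<lambda>x. f x - c) \<in> O[F](\<lambda>_. 1)"
    using f landau_o.big_trans by blast
  from landau_o.big.mult[OF this f']
  have "(\<lambda>x. (f x - c) * (f' x - c')) \<in> O[F](g)" by simp
  moreover have "(\<lambda>x. c * (f' x - c')) \<in> O[F](g)" "(\<lambda>x. c' * (f x - c)) \<in> O[F](g)"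
    using f f' by simp_all
  ultimately have "(\<lambda>x. (f x - c) * (f' x - c') + c * (f' x - c') + c' * (f x - c)) \<in> O[F](g)"
    by (intro sum_in_bigo)
  then show ?thesis by (simp add: algebra_simps)
qed

lemma bigo_approx_tendsto:
  fixes f g :: "'a \<Rightarrow> real"
  assumes f: "(\<lambda>x. f x - c) \<in> O[F](g)" and g: "(g \<longlongrightarrow> 0) F"
  shows "(f \<longlongrightarrow> c) F"
proof -
  have "g \<in> o[F](\<lambda>_. 1)"
    using g by (intro smalloI_tendsto) auto
  then have "(\<lambda>x. f x - c) \<in> o[F](\<lambda>_. 1)"
    using f landau_o.big_small_trans by blast
  then have "((\<lambda>x. f x - c) \<longlongrightarrow> 0) F"
    by (auto dest: smalloD_tendsto)
  then show ?thesis by (simp add: LIM_zero_iff)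
qed

text \<open>By the product rule it is enough to treat the reciprocal. There 1 / f' - 1 / c' is the
  error f' - c' times -1 / (f' c'), and this factor converges because c' is non-zero.\<close>

lemma bigo_approx_divide:
  fixes f f' g :: "'a \<Rightarrow> real"
  assumes f: "(\<lambda>x. f x - c) \<in> O[F](g)" and f': "(\<lambda>x. f' x - c') \<in> O[F](g)"
    and g: "(g \<longlongrightarrow> 0) F" and "c' \<noteq> 0"
  shows "(\<lambda>x. f x / f' x - c / c') \<in> O[F](g)"
proof -
  have lim: "(f' \<longlongrightarrow> c') F" using f' g by (rule bigo_approx_tendsto)
  have "((\<lambda>x. - 1 / (f' x * c')) \<longlongrightarrow> - 1 / (c' * c')) F"
    using \<open>c' \<noteq> 0\<close> by (intro tendsto_intros lim) auto
  then have "(\<lambda>x. - 1 / (f' x * c')) \<in> O[F](\<lambda>_. 1)"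
    by (intro bigoI_tendsto[where c = "- 1 / (c' * c')"]) auto
  from landau_o.big.mult[OF this f']
  have "(\<lambda>x. - 1 / (f' x * c') * (f' x - c')) \<in> O[F](g)" by simp
  moreover have "eventually (\<lambda>x. - 1 / (f' x * c') * (f' x - c') = 1 / f' x - 1 / c') F"
    using tendsto_imp_eventually_ne[OF lim \<open>c' \<noteq> 0\<close>]
    by eventually_elim (use \<open>c' \<noteq> 0\<close> in \<open>simp add: field_simps\<close>)
  ultimately have "(\<lambda>x. 1 / f' x - 1 / c') \<in> O[F](g)"
    by (simp cong: landau_o.big.in_cong)
  from bigo_approx_mult[OF f this g] show ?thesis by simp
qed

section \<open>The angle \<alpha> on each side of 0, and the small parameter\<close>

lemma alpha_props:
  assumes "0 < \<beta>" "\<beta> < 1" "- pi < \<xi>" "\<xi> < pi"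
  shows "- pi < alpha \<beta> \<xi>" "alpha \<beta> \<xi> < pi" "\<xi> = alpha \<beta> \<xi> - \<beta> * \<bar>sin (alpha \<beta> \<xi>)\<bar>"
  using theI'[OF alpha_ex1[OF assms]] unfolding alpha_def by auto

text \<open>Since \<alpha> = \<xi> + \<beta> |sin \<alpha>| is at least \<xi>, it is positive, and
  the absolute value disappears.\<close>

lemma alpha_pos:
  assumes "0 < \<beta>" "\<beta> < 1" "0 < \<xi>" "\<xi> < pi"
  shows "0 < alpha \<beta> \<xi>" "sin (alpha \<beta> \<xi>) > 0" "\<xi> = alpha \<beta> \<xi> - \<beta> * sin (alpha \<beta> \<xi>)"
proof -
  have x: "- pi < \<xi>" using assms pi_gt_zero by linarith
  note a = alpha_props[OF assms(1,2) x assms(4)]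
  have "\<beta> * \<bar>sin (alpha \<beta> \<xi>)\<bar> \<ge> 0" using assms by simp
  with a(3) assms show 1: "0 < alpha \<beta> \<xi>" by linarith
  then show 2: "sin (alpha \<beta> \<xi>) > 0" using a by (intro sin_gt_zero) auto
  then show "\<xi> = alpha \<beta> \<xi> - \<beta> * sin (alpha \<beta> \<xi>)" using a(3) by simp
qed

text \<open>A non-negative \<alpha> would give \<beta> |sin \<alpha>| \<le> \<alpha> and hence \<xi>
  \<ge> 0. In terms of the positive angle -\<alpha> the equation becomes a sum instead of a
  difference, so no cancellation occurs and the angle has the same order as y.\<close>

lemma alpha_neg:
  assumes "0 < \<beta>" "\<beta> < 1" "0 < y" "y < pi"
  shows "0 < - alpha \<beta> (- y)" "sin (- alpha \<beta> (- y)) > 0"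
    "y = - alpha \<beta> (- y) + \<beta> * sin (- alpha \<beta> (- y))"
proof -
  have y: "- pi < - y" "- y < pi" using assms pi_gt_zero by linarith+
  define z where "z = alpha \<beta> (- y)"
  note a = alpha_props[OF assms(1,2) y, folded z_def]
  show 1: "0 < - alpha \<beta> (- y)"
  proof (rule ccontr)
    assume "\<not> ?thesis"
    then have "z \<ge> 0" by (simp add: z_def)
    have "\<beta> * \<bar>sin z\<bar> \<le> 1 * \<bar>z\<bar>"
      by (rule mult_mono) (use assms abs_sin_x_le_abs_x in auto)
    with a(3) \<open>z \<ge> 0\<close> \<open>0 < y\<close> show False by simp
  qed
  then show 2: "sin (- alpha \<beta> (- y)) > 0"
    using a unfolding z_def by (intro sin_gt_zero) auto
  then show "y = - alpha \<beta> (- y) + \<beta> * sin (- alpha \<beta> (- y))"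
    using a(3) unfolding z_def by simp
qed

definition inv_lorentz :: "real \<Rightarrow> real" where
  "inv_lorentz \<beta> = sqrt (1 - \<beta>\<^sup>2)"

lemma lorentz_eq: "0 < \<beta> \<Longrightarrow> \<beta> < 1 \<Longrightarrow> lorentz \<beta> = 1 / inv_lorentz \<beta>"
  by (simp add: lorentz_def inv_lorentz_def powr_minus powr_half_sqrt field_simps power_le_one)

lemma inv_lorentz_pos: "0 < \<beta> \<Longrightarrow> \<beta> < 1 \<Longrightarrow> inv_lorentz \<beta> > 0"
  by (simp add: inv_lorentz_def power_less_one_iff abs_square_less_1)

lemma inv_lorentz_sq: "0 < \<beta> \<Longrightarrow> \<beta> < 1 \<Longrightarrow> (inv_lorentz \<beta>)\<^sup>2 = 1 - \<beta>\<^sup>2"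
  by (simp add: inv_lorentz_def power_le_one)

lemma inv_lorentz_tendsto: "(inv_lorentz \<longlongrightarrow> 0) (at_left 1)"
  unfolding inv_lorentz_def by real_asymp

lemma eventually_at_left_1_unit: "eventually (\<lambda>\<beta>::real. 0 < \<beta> \<and> \<beta> < 1) (at_left 1)"
  using eventually_at_left_real[of 0 "1::real"] by (auto elim: eventually_mono)

section \<open>The limit kernel as an algebraic function\<close>

text \<open>With t = arsinh \<mu> / 3, the arguments occurring in \<open>K_fs\<close> are 3 t, 5 t
  and 6 t. The addition theorems turn everything into polynomials in 2 sinh t, up to a factor cosh t
  that cancels in the quotient.\<close>

lemma sinh_cosh_triple:
  fixes t :: real
  shows "3 * (2 * sinh t) + (2 * sinh t) ^ 3 = 2 * sinh (3 * t)"
    and "cosh (3 * t) = cosh t * (1 + (2 * sinh t)\<^sup>2)"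
    and "cosh (5 * t) - cosh (3 * t) = (2 * sinh t)\<^sup>2 * (2 + (2 * sinh t)\<^sup>2) * cosh t"
proof -
  have c2: "cosh t ^ 2 = sinh t ^ 2 + 1" by (rule cosh_square_eq)
  have s2t: "sinh (2 * t) = 2 * sinh t * cosh t" by (rule sinh_double)
  have c2t: "cosh (2 * t) = 1 + 2 * sinh t ^ 2" using cosh_double[of t] c2 by simp
  have s3: "sinh (3 * t) = 3 * sinh t + 4 * sinh t ^ 3"
  proof -
    have "sinh (3 * t) = sinh (2 * t + t)" by simp
    also have "\<dots> = 2 * sinh t * cosh t ^ 2 + (1 + 2 * sinh t ^ 2) * sinh t"
      unfolding sinh_add s2t c2t by (simp add: power2_eq_square)
    finally show ?thesis unfolding c2 by (simp add: algebra_simps power2_eq_square power3_eq_cube)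
  qed
  show "3 * (2 * sinh t) + (2 * sinh t) ^ 3 = 2 * sinh (3 * t)"
    unfolding s3 by (simp add: power_mult_distrib)
  have c3: "cosh (3 * t) = cosh t * (1 + 4 * sinh t ^ 2)"
  proof -
    have "cosh (3 * t) = cosh (2 * t + t)" by simp
    also have "\<dots> = cosh t * (1 + 4 * sinh t ^ 2)"
      unfolding cosh_add s2t c2t by (simp add: algebra_simps power2_eq_square)
    finally show ?thesis .
  qed
  then show "cosh (3 * t) = cosh t * (1 + (2 * sinh t)\<^sup>2)"
    by (simp add: power_mult_distrib)
  have "cosh (5 * t) = cosh (3 * t + 2 * t)" by simp
  also have "\<dots> = cosh t * ((1 + 4 * sinh t ^ 2) * (1 + 2 * sinh t ^ 2)
       + (3 * sinh t + 4 * sinh t ^ 3) * (2 * sinh t))"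
    unfolding cosh_add s2t c2t c3 s3 by (simp add: algebra_simps)
  finally show "cosh (5 * t) - cosh (3 * t) = (2 * sinh t)\<^sup>2 * (2 + (2 * sinh t)\<^sup>2) * cosh t"
    unfolding c3 by (simp add: algebra_simps power2_eq_square power3_eq_cube)
qed

text \<open>This is the form in which the kernel arises from the potential: a is the limit of the
  rescaled angle, the positive root of the cubic. The denominator comes from sinh (6 t) = 2 sinh (3
  t) cosh (3 t) with sinh (3 t) = \<mu>.\<close>

lemma K_fs_algebraic:
  fixes \<mu> :: real
  assumes "\<mu> > 0"
  obtains a where "a > 0" "3 * a + a ^ 3 = 2 * \<mu>"
    "K_fs \<mu> = a\<^sup>2 * (2 + a\<^sup>2) / (\<mu> * (1 + a\<^sup>2))"
proof
  define t where "t = arsinh \<mu> / 3"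
  define a where "a = 2 * sinh t"
  have t3: "sinh (3 * t) = \<mu>" by (simp add: t_def)
  have "t > 0" using assms by (simp add: t_def)
  then show "a > 0" by (simp add: a_def)
  show "3 * a + a ^ 3 = 2 * \<mu>" using sinh_cosh_triple(1)[of t] by (simp add: a_def t3)
  have d: "sinh (2 * (3 * t)) = 2 * \<mu> * (cosh t * (1 + a\<^sup>2))"
    unfolding sinh_double t3 sinh_cosh_triple(2) a_def by simp
  have "K_fs \<mu> = 2 * ((cosh (5 * t) - cosh (3 * t)) / sinh (2 * (3 * t)))"
    using assms by (simp add: K_fs_def t_def)
  also have "\<dots> = a\<^sup>2 * (2 + a\<^sup>2) / (\<mu> * (1 + a\<^sup>2))"
    unfolding d sinh_cosh_triple(3) a_def[symmetric] using cosh_real_pos[of t] by simp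
  finally show "K_fs \<mu> = a\<^sup>2 * (2 + a\<^sup>2) / (\<mu> * (1 + a\<^sup>2))" .
qed

section \<open>The potential for negative \<mu>\<close>

lemma V_S_neg_bigo:
  fixes m :: real
  assumes "m > 0"
  shows "(\<lambda>\<beta>. V_S \<beta> (- (m * inv_lorentz \<beta> ^ 3))) \<in> O[at_left 1](\<lambda>\<beta>. inv_lorentz \<beta> ^ 3)"
proof -
  let ?F = "at_left (1::real)"
  define e where "e = inv_lorentz"
  define y where "y \<beta> = m * e \<beta> ^ 3" for \<beta>
  define x where "x \<beta> = - alpha \<beta> (- y \<beta>)" for \<beta>
  have "(y \<longlongrightarrow> m * 0 ^ 3) ?F"
    unfolding y_def e_def by (intro tendsto_intros inv_lorentz_tendsto)
  then have y0: "(y \<longlongrightarrow> 0) ?F" by simp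
  \<comment> \<open>As x \<le> y, the bound \<open>pi / 2\<close> also gives cos x \<ge> 0, which
    keeps the factor 1 + \<beta> cos x of the denominator at least 1.\<close>
  have "eventually (\<lambda>\<beta>. y \<beta> < pi / 2) ?F"
    using y0 by (rule order_tendstoD) simp
  with eventually_at_left_1_unit
  have ev: "eventually (\<lambda>\<beta>. 0 < \<beta> \<and> \<beta> < 1 \<and> 0 < e \<beta> \<and> (e \<beta>)\<^sup>2 = 1 - \<beta>\<^sup>2 \<and> 0 < y \<beta> \<and> y \<beta> < pi / 2 \<and>
      0 < x \<beta> \<and> 0 < sin (x \<beta>) \<and> y \<beta> = x \<beta> + \<beta> * sin (x \<beta>) \<and> x \<beta> \<le> y \<beta> \<and> y \<beta> \<le> 2 * x \<beta>) ?F"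
  proof eventually_elim
    case (elim b)
    have e: "e b > 0" "(e b)\<^sup>2 = 1 - b\<^sup>2" using elim inv_lorentz_pos inv_lorentz_sq by (auto simp: e_def)
    have y: "0 < y b" "y b < pi" using e assms elim pi_gt_zero unfolding y_def by (auto simp del: pi_gt_zero)
    note n = alpha_neg[of b "y b", folded x_def]
    have n': "0 < x b" "0 < sin (x b)" "y b = x b + b * sin (x b)" using n elim y by auto
    have "0 \<le> b * sin (x b)" using n' elim by simp
    moreover have "b * sin (x b) \<le> 1 * x b"
      by (rule mult_mono) (use elim n' sin_x_le_x in auto)
    ultimately show ?case using e y n' elim by auto
  qed
  have x0: "(x \<longlongrightarrow> 0) ?F"
    by (rule tendsto_sandwich[OF _ _ tendsto_const y0]) (use ev in \<open>auto elim!: eventually_mono\<close>)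
  \<comment> \<open>Positivity turns convergence to 0 into convergence from the right, so that
    one-variable expansions at 0+ can be composed with x and y.\<close>
  have limx: "filterlim x (at_right 0) ?F"
    using x0 ev unfolding at_within_def by (auto simp: filterlim_inf filterlim_principal elim!: eventually_mono)
  have limy: "filterlim y (at_right 0) ?F"
    using y0 ev unfolding at_within_def by (auto simp: filterlim_inf filterlim_principal elim!: eventually_mono)
  have y_eq: "y = (\<lambda>\<beta>. m * e \<beta> ^ 3)" by (simp add: y_def fun_eq_iff)
  have ye: "y \<in> O[?F](\<lambda>\<beta>. e \<beta> ^ 3)" unfolding y_eq by simp
  have ey: "(\<lambda>\<beta>. e \<beta> ^ 3) \<in> O[?F](y)" unfolding y_eq using assms by simp
  have xy: "x \<in> O[?F](y)"
    by (rule bigoI[of _ 1]) (use ev in \<open>auto elim!: eventually_mono\<close>)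
  have yx: "y \<in> O[?F](x)"
    by (rule bigoI[of _ 2]) (use ev in \<open>auto elim!: eventually_mono\<close>)
  have xe: "x \<in> O[?F](\<lambda>\<beta>. e \<beta> ^ 3)" using xy ye landau_o.big_trans by blast
  have x3: "(\<lambda>\<beta>. x \<beta> ^ 3) \<in> O[?F](\<lambda>\<beta>. e \<beta> ^ 9)"
    using landau_o.big_power[OF xe, of 3] by (simp flip: power_mult)
  have y3: "(\<lambda>\<beta>. y \<beta> ^ 3) \<in> O[?F](\<lambda>\<beta>. e \<beta> ^ 9)"
    using landau_o.big_power[OF ye, of 3] by (simp flip: power_mult)
  have b1: "(\<lambda>\<beta>. \<beta>) \<in> O[?F](\<lambda>_. 1)" by real_asymp
  have one: "(\<lambda>\<beta>. e \<beta> ^ k) \<in> O[?F](\<lambda>_. 1)" for k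
    using tendsto_power[OF inv_lorentz_tendsto, of k] unfolding e_def
    by (intro bigoI_tendsto[where c = "0 ^ k"]) auto

  have 1: "(\<lambda>\<beta>. sin (y \<beta>) - y \<beta>) \<in> O[?F](\<lambda>\<beta>. e \<beta> ^ 9)"
  proof -
    have "(\<lambda>x::real. sin x - x) \<in> O[at_right 0](\<lambda>x. x ^ 3)" by real_asymp
    from landau_o.big.compose[OF this limy] show ?thesis using y3 landau_o.big_trans by blast
  qed
  have 2: "(\<lambda>\<beta>. sin (x \<beta>) - x \<beta>) \<in> O[?F](\<lambda>\<beta>. e \<beta> ^ 9)"
  proof -
    have "(\<lambda>x::real. sin x - x) \<in> O[at_right 0](\<lambda>x. x ^ 3)" by real_asymp
    from landau_o.big.compose[OF this limx] show ?thesis using x3 landau_o.big_trans by blast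
  qed
  have 3: "(\<lambda>\<beta>. \<beta> * (sin (x \<beta>) * (cos (x \<beta>) - 1))) \<in> O[?F](\<lambda>\<beta>. e \<beta> ^ 9)"
  proof -
    have "(\<lambda>x::real. sin x * (cos x - 1)) \<in> O[at_right 0](\<lambda>x. x ^ 3)" by real_asymp
    from landau_o.big.compose[OF this limx]
    have "(\<lambda>\<beta>. sin (x \<beta>) * (cos (x \<beta>) - 1)) \<in> O[?F](\<lambda>\<beta>. e \<beta> ^ 9)"
      using x3 landau_o.big_trans by blast
    from landau_o.big.mult[OF b1 this] show ?thesis by simp
  qed
  have sx: "(\<lambda>\<beta>. sin (x \<beta>)) \<in> O[?F](\<lambda>\<beta>. e \<beta> ^ 3)"
  proof -
    have "(\<lambda>x::real. sin x) \<in> O[at_right 0](\<lambda>x. x)" by real_asymp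
    from landau_o.big.compose[OF this limx] show ?thesis using xe landau_o.big_trans by blast
  qed
  have sy: "(\<lambda>\<beta>. sin (y \<beta>)) \<in> O[?F](\<lambda>\<beta>. e \<beta> ^ 3)"
  proof -
    have "(\<lambda>x::real. sin x) \<in> O[at_right 0](\<lambda>x. x)" by real_asymp
    from landau_o.big.compose[OF this limy] show ?thesis using ye landau_o.big_trans by blast
  qed
  \<comment> \<open>The bracket is sin y - sin x - \<beta> sin x cos x with -y + x + \<beta> sin x
    added, which is 0 by the equation for the angle. In this grouping each term is cubic in x or y,
    hence O(e^9).\<close>
  define N where "N \<beta> = (e \<beta>)\<^sup>2 * ((sin (y \<beta>) - y \<beta>) - (sin (x \<beta>) - x \<beta>) - \<beta> * (sin (x \<beta>) * (cos (x \<beta>) - 1)))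
      + 2 * (\<beta> * (\<beta> * (sin (x \<beta>) * (sin (x \<beta>) * sin (y \<beta>)))))" for \<beta>
  define D where "D \<beta> = 2 * (sin (y \<beta>) * (sin (x \<beta>) * (1 + \<beta> * cos (x \<beta>))))" for \<beta>
  have N: "N \<in> O[?F](\<lambda>\<beta>. e \<beta> ^ 9)"
  proof -
    have "(\<lambda>\<beta>. (sin (y \<beta>) - y \<beta>) - (sin (x \<beta>) - x \<beta>) - \<beta> * (sin (x \<beta>) * (cos (x \<beta>) - 1))) \<in> O[?F](\<lambda>\<beta>. e \<beta> ^ 9)"
      by (intro sum_in_bigo 1 2 3)
    \<comment> \<open>The other summand of N is bounded only by O(e^9), so boundedness of e^2
      suffices here.\<close>
    from landau_o.big.mult[OF one[of 2] this]
    have "(\<lambda>\<beta>. (e \<beta>)\<^sup>2 * ((sin (y \<beta>) - y \<beta>) - (sin (x \<beta>) - x \<beta>) - \<beta> * (sin (x \<beta>) * (cos (x \<beta>) - 1)))) \<in> O[?F](\<lambda>\<beta>. e \<beta> ^ 9)"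
      by simp
    moreover have "(\<lambda>\<beta>. \<beta> * (\<beta> * (sin (x \<beta>) * (sin (x \<beta>) * sin (y \<beta>))))) \<in> O[?F](\<lambda>\<beta>. 1 * (1 * (e \<beta> ^ 3 * (e \<beta> ^ 3 * e \<beta> ^ 3))))"
      by (intro landau_o.big.mult b1 sx sy)
    then have "(\<lambda>\<beta>. 2 * (\<beta> * (\<beta> * (sin (x \<beta>) * (sin (x \<beta>) * sin (y \<beta>)))))) \<in> O[?F](\<lambda>\<beta>. e \<beta> ^ 9)"
      by (simp flip: power_add)
    ultimately show ?thesis unfolding N_def by (intro sum_in_bigo)
  qed
  have D: "(\<lambda>\<beta>. e \<beta> ^ 6) \<in> O[?F](D)"
  proof -
    have s: "(\<lambda>x::real. x) \<in> O[at_right 0](\<lambda>x. sin x)" by real_asymp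
    have y: "(\<lambda>\<beta>. e \<beta> ^ 3) \<in> O[?F](\<lambda>\<beta>. sin (y \<beta>))"
      using landau_o.big.compose[OF s limy] ey landau_o.big_trans by blast
    have x: "(\<lambda>\<beta>. e \<beta> ^ 3) \<in> O[?F](\<lambda>\<beta>. sin (x \<beta>))"
      using landau_o.big.compose[OF s limx] ey yx landau_o.big_trans by blast
    have c: "(\<lambda>\<beta>. 1) \<in> O[?F](\<lambda>\<beta>. 1 + \<beta> * cos (x \<beta>))"
    proof (rule bigoI[of _ 1], rule eventually_mono[OF ev])
      fix b assume "0 < b \<and> b < 1 \<and> 0 < e b \<and> (e b)\<^sup>2 = 1 - b\<^sup>2 \<and> 0 < y b \<and> y b < pi / 2 \<and>
        0 < x b \<and> 0 < sin (x b) \<and> y b = x b + b * sin (x b) \<and> x b \<le> y b \<and> y b \<le> 2 * x b"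
      moreover from this have "cos (x b) \<ge> 0" by (intro cos_ge_zero) auto
      ultimately show "norm (1::real) \<le> 1 * norm (1 + b * cos (x b))" by simp
    qed
    have "(\<lambda>\<beta>. e \<beta> ^ 3 * (e \<beta> ^ 3 * 1)) \<in> O[?F](\<lambda>\<beta>. sin (y \<beta>) * (sin (x \<beta>) * (1 + \<beta> * cos (x \<beta>))))"
      by (intro landau_o.big.mult y x c)
    then show ?thesis unfolding D_def by (simp flip: power_add)
  qed
  \<comment> \<open>The lower bound on D is multiplied with the upper bound on N, and D is divided
    out pointwise. Where D vanishes, N / D is 0 and the estimate is trivial.\<close>
  have "(\<lambda>\<beta>. e \<beta> ^ 6 * (N \<beta> / D \<beta>)) \<in> O[?F](\<lambda>\<beta>. e \<beta> ^ 9)"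
  proof -
    have "(\<lambda>\<beta>. e \<beta> ^ 6 * N \<beta>) \<in> O[?F](\<lambda>\<beta>. D \<beta> * e \<beta> ^ 9)"
      by (rule landau_o.big.mult[OF D N])
    then obtain c where "c > 0" and c: "eventually (\<lambda>\<beta>. norm (e \<beta> ^ 6 * N \<beta>) \<le> c * norm (D \<beta> * e \<beta> ^ 9)) ?F"
      by (elim landau_o.bigE)
    show ?thesis
    proof (rule bigoI[of _ c], rule eventually_mono[OF c])
      fix b assume *: "norm (e b ^ 6 * N b) \<le> c * norm (D b * e b ^ 9)"
      show "norm (e b ^ 6 * (N b / D b)) \<le> c * norm (e b ^ 9)"
        using * \<open>c > 0\<close> by (cases "D b = 0") (auto simp: abs_mult field_simps)
    qed
  qed
  then have "(\<lambda>\<beta>. N \<beta> / D \<beta>) \<in> O[?F](\<lambda>\<beta>. e \<beta> ^ 3)"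
  proof -
    assume "(\<lambda>\<beta>. e \<beta> ^ 6 * (N \<beta> / D \<beta>)) \<in> O[?F](\<lambda>\<beta>. e \<beta> ^ 9)"
    then have "(\<lambda>\<beta>. e \<beta> ^ 6 * (N \<beta> / D \<beta>)) \<in> O[?F](\<lambda>\<beta>. e \<beta> ^ 6 * e \<beta> ^ 3)"
      by (simp flip: power_add)
    then show ?thesis
      by (subst (asm) landau_o.big.mult_cancel_left) (use ev in \<open>auto elim!: eventually_mono\<close>)
  qed
  moreover have "eventually (\<lambda>\<beta>. V_S \<beta> (- (m * inv_lorentz \<beta> ^ 3)) = N \<beta> / D \<beta>) ?F"
    using ev
  proof eventually_elim
    case (elim b)
    have sy: "sin (y b) > 0" using elim by (intro sin_gt_zero) auto
    have sx: "sin (x b) > 0" and e2: "(e b)\<^sup>2 = 1 - b\<^sup>2" using elim by auto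
    have al: "alpha b (- y b) = - x b" by (simp add: x_def)
    have xi: "- (m * inv_lorentz b ^ 3) = - y b" by (simp add: y_def e_def)
    have yy: "(sin (y b) - y b) - (sin (x b) - x b) - b * (sin (x b) * (cos (x b) - 1))
      = sin (y b) - sin (x b) - b * sin (x b) * cos (x b)"
      using elim by (simp add: algebra_simps)
    have "V_S b (- y b) = N b / D b"
      unfolding V_S_def Let_def al N_def D_def yy e2 using sx sy
      by (simp add: algebra_simps power2_eq_square)
    then show ?case by (simp only: xi)
  qed
  ultimately show ?thesis unfolding e_def by (simp cong: landau_o.big.in_cong)
qed

section \<open>The potential for positive \<mu>\<close>

lemma V_S_pos_bigo:
  fixes \<mu> a :: real
  assumes "\<mu> > 0" "a > 0" "3 * a + a ^ 3 = 2 * \<mu>"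
  shows "(\<lambda>\<beta>. V_S \<beta> (\<mu> / 3 * inv_lorentz \<beta> ^ 3)
       - a\<^sup>2 * (2 + a\<^sup>2) / (\<mu> * (1 + a\<^sup>2)) / inv_lorentz \<beta>) \<in> O[at_left 1](inv_lorentz)"
proof -
  let ?F = "at_left (1::real)"
  define e where "e = inv_lorentz"
  define y where "y \<beta> = \<mu> / 3 * e \<beta> ^ 3" for \<beta>
  define x where "x \<beta> = alpha \<beta> (y \<beta>)" for \<beta>
  have mu: "\<mu> = (3 * a + a ^ 3) / 2" using assms(3) by simp
  let ?g = "\<lambda>\<beta>. (e \<beta>)\<^sup>2"
  have g: "(?g \<longlongrightarrow> 0) ?F"
    using tendsto_power[OF inv_lorentz_tendsto, of 2] by (simp add: e_def)
  have "(y \<longlongrightarrow> \<mu> / 3 * 0 ^ 3) ?F"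
    unfolding y_def e_def by (intro tendsto_intros inv_lorentz_tendsto) auto
  then have y0: "(y \<longlongrightarrow> 0) ?F" by simp
  have "eventually (\<lambda>\<beta>. y \<beta> < pi) ?F"
    using y0 by (rule order_tendstoD) simp
  with eventually_at_left_1_unit
  have ev: "eventually (\<lambda>\<beta>. 0 < \<beta> \<and> \<beta> < 1 \<and> 0 < e \<beta> \<and> (e \<beta>)\<^sup>2 = 1 - \<beta>\<^sup>2 \<and> 0 < y \<beta> \<and> y \<beta> < pi \<and>
      0 < x \<beta> \<and> 0 < sin (x \<beta>) \<and> y \<beta> = x \<beta> - \<beta> * sin (x \<beta>) \<and> x \<beta> \<le> 2 * \<mu> / 3 * e \<beta>) ?F"
  proof eventually_elim
    case (elim b)
    have e: "e b > 0" "(e b)\<^sup>2 = 1 - b\<^sup>2" using elim inv_lorentz_pos inv_lorentz_sq by (auto simp: e_def)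
    have y: "0 < y b" using e assms elim unfolding y_def by auto
    note n = alpha_pos[of b "y b", folded x_def]
    have n': "0 < x b" "0 < sin (x b)" "y b = x b - b * sin (x b)" using n elim y by auto
    \<comment> \<open>A priori bound x = O(e): sin x \<le> x gives (1 - b) x \<le> y, and e^2 = (1 -
      b) (1 + b) \<le> 2 (1 - b), so e^2 x \<le> 2 y = (2 \<mu> / 3) e^3.\<close>
    have "b * sin (x b) \<le> b * x b"
      by (rule mult_left_mono) (use elim n' sin_x_le_x in auto)
    then have "(1 - b) * x b \<le> y b" using n' by (simp add: algebra_simps)
    moreover have "(e b)\<^sup>2 \<le> 2 * (1 - b)"
    proof -
      have "2 * (1 - b) - (1 - b\<^sup>2) = (1 - b)\<^sup>2" by (simp add: power2_eq_square algebra_simps)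
      then show ?thesis unfolding e(2) by (smt (verit) zero_le_power2)
    qed
    then have "(e b)\<^sup>2 * x b \<le> 2 * (1 - b) * x b" using n'(1) by (intro mult_right_mono) simp_all
    then have "(e b)\<^sup>2 * x b \<le> 2 * ((1 - b) * x b)" by (simp only: mult.assoc)
    ultimately have "(e b)\<^sup>2 * x b \<le> 2 * y b" by linarith
    also have "2 * y b = (e b)\<^sup>2 * (2 * \<mu> / 3 * e b)" by (simp add: y_def power2_eq_square power3_eq_cube)
    finally have "x b \<le> 2 * \<mu> / 3 * e b"
      by (rule mult_left_le_imp_le) (use e(1) in simp)
    then show ?case using e y n' elim by auto
  qed
  have xe: "x \<in> O[?F](e)"
    by (rule bigoI[of _ "2 * \<mu> / 3"]) (use ev assms in \<open>auto elim!: eventually_mono\<close>)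
  have x0: "(x \<longlongrightarrow> 0) ?F"
  proof (rule tendsto_sandwich[OF _ _ tendsto_const])
    show "((\<lambda>\<beta>. 2 * \<mu> / 3 * e \<beta>) \<longlongrightarrow> 0) ?F"
      using tendsto_mult_right_zero[OF inv_lorentz_tendsto, of "2 * \<mu> / 3"] by (simp add: e_def)
  qed (use ev in \<open>auto elim!: eventually_mono\<close>)
  have limx: "filterlim x (at_right 0) ?F"
    using x0 ev unfolding at_within_def by (auto simp: filterlim_inf filterlim_principal elim!: eventually_mono)
  have limy: "filterlim y (at_right 0) ?F"
    using y0 ev unfolding at_within_def by (auto simp: filterlim_inf filterlim_principal elim!: eventually_mono)
  have e_nz: "eventually (\<lambda>\<beta>. e \<beta> ^ k \<noteq> 0) ?F" for k
    using ev by eventually_elim simp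
  \<comment> \<open>A Taylor remainder two orders beyond x^k becomes a relative error O(e^2) after
    division by e^k. It is applied with k = 3, 1 and 2, to sin x - x + x^3 / 6, sin x - x and 1 -
    cos x - x^2 / 2.\<close>
  have comp: "(\<lambda>\<beta>. f (x \<beta>) / e \<beta> ^ k) \<in> O[?F](?g)" if "f \<in> O[at_right 0](\<lambda>x::real. x ^ (k + 2))"
    for f :: "real \<Rightarrow> real" and k
  proof -
    have "(\<lambda>\<beta>. f (x \<beta>)) \<in> O[?F](\<lambda>\<beta>. x \<beta> ^ (k + 2))"
      using landau_o.big.compose[OF that limx] .
    also have "(\<lambda>\<beta>. x \<beta> ^ (k + 2)) \<in> O[?F](\<lambda>\<beta>. e \<beta> ^ (k + 2))"
      by (rule landau_o.big_power[OF xe])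
    also have "(\<lambda>\<beta>. e \<beta> ^ (k + 2)) = (\<lambda>\<beta>. ?g \<beta> * e \<beta> ^ k)"
      by (simp only: power_add mult.commute)
    finally show ?thesis
      by (rule landau_o.big.divide_eq2[OF e_nz, THEN iffD2])
  qed
  define A where "A \<beta> = x \<beta> / e \<beta>" for \<beta>
  define R where "R \<beta> = (sin (x \<beta>) - x \<beta> + x \<beta> ^ 3 / 6) / e \<beta> ^ 3" for \<beta>
  define B where "B \<beta> = (1 - \<beta>) / (e \<beta>)\<^sup>2" for \<beta>
  have b1: "(\<lambda>\<beta>. \<beta> - 1) \<in> O[?F](?g)"
    unfolding e_def inv_lorentz_def by real_asymp
  have B: "(\<lambda>\<beta>. B \<beta> - 1 / 2) \<in> O[?F](?g)"
  proof -
    \<comment> \<open>For \<beta> in (0, 1), B equals 1 / (1 + \<beta>) exactly, because e^2 = (1 -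
      \<beta>) (1 + \<beta>).\<close>
    have "(\<lambda>\<beta>::real. 1 / (1 + \<beta>) - 1 / 2) \<in> O[?F](\<lambda>\<beta>. 1 - \<beta>\<^sup>2)" by real_asymp
    also have "?this \<longleftrightarrow> ?thesis"
    proof (intro landau_o.big.cong_ex)
      show "eventually (\<lambda>\<beta>. 1 / (1 + \<beta>) - 1 / 2 = B \<beta> - 1 / 2) ?F"
        using ev
      proof eventually_elim
        case (elim b)
        have "(e b)\<^sup>2 = (1 - b) * (1 + b)" using elim by (simp add: power2_eq_square algebra_simps)
        then show ?case using elim by (simp add: B_def)
      qed
    qed (use ev in \<open>auto elim!: eventually_mono\<close>)
    finally show ?thesis .
  qed
  have R: "(\<lambda>\<beta>. R \<beta> - 0) \<in> O[?F](?g)"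
    unfolding R_def diff_0_right by (rule comp) (real_asymp)
  have Abd: "(\<lambda>\<beta>. A \<beta>) \<in> O[?F](\<lambda>_. 1)"
    by (rule bigoI[of _ "2 * \<mu> / 3"])
       (use ev assms in \<open>auto simp: A_def field_simps elim!: eventually_mono\<close>)
  \<comment> \<open>Dividing the equation for the angle by e^3 gives \<mu> / 3 = B A + \<beta> (A^3
    / 6 - R). Replacing B by 1 / 2, \<beta> by 1 and R by 0 costs exactly the three terms on the
    right.\<close>
  have key: "eventually (\<lambda>\<beta>. (A \<beta> / 2 + A \<beta> ^ 3 / 6) - \<mu> / 3
      = \<beta> * R \<beta> - A \<beta> * (B \<beta> - 1 / 2) - (\<beta> - 1) * (A \<beta> ^ 3 / 6)) ?F"
    using ev
  proof eventually_elim
    case (elim b)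
    have x: "x b = A b * e b" using elim by (simp add: A_def)
    have "e b > 0" using elim by simp
    then have B: "1 - b = B b * (e b)\<^sup>2" by (simp add: B_def)
    have R: "sin (x b) = x b - x b ^ 3 / 6 + R b * e b ^ 3" using elim by (simp add: R_def)
    have "\<mu> / 3 * e b ^ 3 = x b - b * sin (x b)" using elim by (simp add: y_def)
    also have "\<dots> = (1 - b) * x b + b * (x b ^ 3 / 6 - R b * e b ^ 3)"
      unfolding R by (simp add: algebra_simps)
    also have "\<dots> = (B b * A b + b * (A b ^ 3 / 6 - R b)) * e b ^ 3"
      unfolding B unfolding x by (simp add: algebra_simps power2_eq_square power3_eq_cube)
    finally have "\<mu> / 3 = B b * A b + b * (A b ^ 3 / 6 - R b)" using elim by simp
    then show ?case by (simp add: field_simps)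
  qed
  have "(\<lambda>\<beta>. \<beta> * R \<beta> - A \<beta> * (B \<beta> - 1 / 2) - (\<beta> - 1) * (A \<beta> ^ 3 / 6)) \<in> O[?F](?g)"
  proof -
    have "(\<lambda>\<beta>. \<beta> * R \<beta>) \<in> O[?F](?g)"
      using bigo_approx_mult[OF b1 R g] by simp
    moreover have "(\<lambda>\<beta>. A \<beta> * (B \<beta> - 1 / 2)) \<in> O[?F](?g)"
      using landau_o.big.mult[OF Abd B] by simp
    moreover have "(\<lambda>\<beta>. (\<beta> - 1) * (A \<beta> ^ 3 / 6)) \<in> O[?F](?g)"
      using landau_o.big.mult[OF b1 landau_o.big_power[OF Abd, of 3]] by simp
    ultimately show ?thesis by (intro sum_in_bigo)
  qed
  then have cubic: "(\<lambda>\<beta>. (A \<beta> / 2 + A \<beta> ^ 3 / 6) - \<mu> / 3) \<in> O[?F](?g)"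
    by (rule landau_o.big.in_cong[OF key, THEN iffD2])
  have A: "(\<lambda>\<beta>. A \<beta> - a) \<in> O[?F](?g)"
  proof -
    have "(\<lambda>\<beta>. A \<beta> - a) \<in> O[?F](\<lambda>\<beta>. (A \<beta> / 2 + A \<beta> ^ 3 / 6) - \<mu> / 3)"
    proof (rule bigoI[of _ 2], rule eventually_mono[OF ev])
      fix b assume "0 < b \<and> b < 1 \<and> 0 < e b \<and> (e b)\<^sup>2 = 1 - b\<^sup>2 \<and> 0 < y b \<and> y b < pi \<and>
        0 < x b \<and> 0 < sin (x b) \<and> y b = x b - b * sin (x b) \<and> x b \<le> 2 * \<mu> / 3 * e b"
      then have "A b > 0" by (simp add: A_def)
      \<comment> \<open>Since \<mu> / 3 is the value of the cubic at a, the difference contains the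
        factor A - a. The cofactor is at least 1, which gives the constant 2.\<close>
      have "2 * (A b / 2 + A b ^ 3 / 6 - \<mu> / 3) = (A b - a) * (1 + ((A b)\<^sup>2 + A b * a + a\<^sup>2) / 3)"
        unfolding mu by (simp add: field_simps power2_eq_square power3_eq_cube)
      moreover have pos: "(A b)\<^sup>2 + A b * a + a\<^sup>2 \<ge> 0"
        using \<open>A b > 0\<close> \<open>a > 0\<close> by simp
      ultimately have "\<bar>2 * (A b / 2 + A b ^ 3 / 6 - \<mu> / 3)\<bar> = \<bar>A b - a\<bar> * (1 + ((A b)\<^sup>2 + A b * a + a\<^sup>2) / 3)"
        using abs_of_nonneg[of "1 + ((A b)\<^sup>2 + A b * a + a\<^sup>2) / 3"] by (simp only: abs_mult) simp
      then have "2 * norm (A b / 2 + A b ^ 3 / 6 - \<mu> / 3) = \<bar>A b - a\<bar> * (1 + ((A b)\<^sup>2 + A b * a + a\<^sup>2) / 3)"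
        by (simp only: abs_mult abs_numeral real_norm_def)
      also have "\<dots> \<ge> \<bar>A b - a\<bar> * 1"
        using pos by (intro mult_left_mono) simp_all
      finally show "norm (A b - a) \<le> 2 * norm (A b / 2 + A b ^ 3 / 6 - \<mu> / 3)" by simp
    qed
    then show ?thesis using cubic landau_o.big_trans by blast
  qed
  define S where "S \<beta> = sin (x \<beta>) / e \<beta>" for \<beta>
  define C where "C \<beta> = (1 - \<beta> * cos (x \<beta>)) / (e \<beta>)\<^sup>2" for \<beta>
  define Y where "Y \<beta> = sin (y \<beta>) / e \<beta> ^ 3" for \<beta>
  \<comment> \<open>Constants count as approximations without error. The limits below stay
    unsimplified, as in \<open>1 * (a * a * (1 / 2))\<close>, to match the sum and product rules
    term by term.\<close>
  have const: "(\<lambda>_. c - c) \<in> O[?F](?g)" for c :: real by simp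
  have S: "(\<lambda>\<beta>. S \<beta> - a) \<in> O[?F](?g)"
  proof -
    have "(\<lambda>\<beta>. (sin (x \<beta>) - x \<beta>) / e \<beta> ^ 1) \<in> O[?F](?g)"
      by (rule comp) real_asymp
    from sum_in_bigo(1)[OF this A] show ?thesis
      by (simp add: S_def A_def diff_divide_distrib)
  qed
  have C: "(\<lambda>\<beta>. C \<beta> - (1 / 2 + 1 * (a * a * (1 / 2)))) \<in> O[?F](?g)"
  proof -
    have "(\<lambda>\<beta>. (1 - cos (x \<beta>) - x \<beta> ^ 2 / 2) / e \<beta> ^ 2) \<in> O[?F](?g)"
      by (rule comp) real_asymp
    moreover have "(\<lambda>\<beta>. A \<beta> * A \<beta> * (1 / 2) - a * a * (1 / 2)) \<in> O[?F](?g)"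
      by (intro bigo_approx_mult A g const)
    ultimately have "(\<lambda>\<beta>. (1 - cos (x \<beta>) - x \<beta> ^ 2 / 2) / e \<beta> ^ 2 + (A \<beta> * A \<beta> * (1 / 2) - a * a * (1 / 2))) \<in> O[?F](?g)"
      by (rule sum_in_bigo)
    also have "(\<lambda>\<beta>. (1 - cos (x \<beta>) - x \<beta> ^ 2 / 2) / e \<beta> ^ 2 + (A \<beta> * A \<beta> * (1 / 2) - a * a * (1 / 2)))
      = (\<lambda>\<beta>. (1 - cos (x \<beta>)) / e \<beta> ^ 2 - a * a * (1 / 2))"
      by (simp add: A_def diff_divide_distrib power2_eq_square fun_eq_iff)
    \<comment> \<open>Split 1 - \<beta> cos x = (1 - \<beta>) + \<beta> (1 - cos x): both parts have
      order e^2, so both contribute to the limit (1 + a^2) / 2 of C.\<close>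
    finally have "(\<lambda>\<beta>. (B \<beta> + \<beta> * ((1 - cos (x \<beta>)) / e \<beta> ^ 2)) - (1 / 2 + 1 * (a * a * (1 / 2)))) \<in> O[?F](?g)"
      by (intro bigo_approx_add bigo_approx_mult B b1 g)
    moreover have "B \<beta> + \<beta> * ((1 - cos (x \<beta>)) / e \<beta> ^ 2) = C \<beta>" for \<beta>
      unfolding B_def C_def times_divide_eq_right add_divide_distrib[symmetric]
      by (simp add: algebra_simps)
    ultimately show ?thesis by simp
  qed
  have Y: "(\<lambda>\<beta>. Y \<beta> - \<mu> / 3) \<in> O[?F](?g)"
  proof -
    have "(\<lambda>x::real. sin x - x) \<in> O[at_right 0](\<lambda>x. x ^ 3)" by real_asymp
    from landau_o.big.compose[OF this limy]
    have "(\<lambda>\<beta>. sin (y \<beta>) - y \<beta>) \<in> O[?F](\<lambda>\<beta>. y \<beta> ^ 3)" .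
    also have "(\<lambda>\<beta>. y \<beta> ^ 3) \<in> O[?F](\<lambda>\<beta>. (e \<beta> ^ 3) ^ 3)"
      by (rule landau_o.big_power) (simp add: y_def[abs_def])
    also have "(\<lambda>\<beta>. (e \<beta> ^ 3) ^ 3) \<in> O[?F](\<lambda>\<beta>. ?g \<beta> * e \<beta> ^ 3)"
      unfolding e_def inv_lorentz_def by real_asymp
    finally have "(\<lambda>\<beta>. (sin (y \<beta>) - y \<beta>) / e \<beta> ^ 3) \<in> O[?F](?g)"
      by (rule landau_o.big.divide_eq2[OF e_nz, THEN iffD2])
    moreover have "eventually (\<lambda>\<beta>. (sin (y \<beta>) - y \<beta>) / e \<beta> ^ 3 = Y \<beta> - \<mu> / 3) ?F"
      using ev by eventually_elim (simp add: Y_def y_def field_simps)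
    ultimately show ?thesis by (simp cong: landau_o.big.in_cong)
  qed
  \<comment> \<open>With sin x = S e, sin y = Y e^3 and 1 - \<beta> cos x = C e^2, the numerator of
    the potential is e^5 N and its denominator e^6 D.\<close>
  define N where "N \<beta> = Y \<beta> + (- 1) * (S \<beta> * C \<beta>) + 2 * (\<beta> * \<beta>) * (S \<beta> * S \<beta>) * Y \<beta>" for \<beta>
  define D where "D \<beta> = 2 * Y \<beta> * (S \<beta> * C \<beta>)" for \<beta>
  define c where "c = 1 / 2 + 1 * (a * a * (1 / 2))"
  have N: "(\<lambda>\<beta>. N \<beta> - (\<mu> / 3 + (- 1) * (a * c) + 2 * (1 * 1) * (a * a) * (\<mu> / 3))) \<in> O[?F](?g)"
    unfolding N_def c_def by (intro bigo_approx_add bigo_approx_mult Y S C b1 g const)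
  have D: "(\<lambda>\<beta>. D \<beta> - 2 * (\<mu> / 3) * (a * c)) \<in> O[?F](?g)"
    unfolding D_def c_def by (intro bigo_approx_mult Y S C b1 g const)
  have c0: "c > 0" unfolding c_def using assms by (intro add_pos_pos mult_pos_pos) auto
  have lim: "(\<mu> / 3 + (- 1) * (a * c) + 2 * (1 * 1) * (a * a) * (\<mu> / 3)) / (2 * (\<mu> / 3) * (a * c))
     = a\<^sup>2 * (2 + a\<^sup>2) / (\<mu> * (1 + a\<^sup>2))"
  proof -
    have c: "2 * c = 1 + a\<^sup>2" by (simp add: c_def power2_eq_square)
    \<comment> \<open>Inserting \<mu> = (3 a + a^3) / 2 cancels the terms linear in a.\<close>
    have n: "\<mu> / 3 + (- 1) * (a * c) + 2 * (1 * 1) * (a * a) * (\<mu> / 3) = a / 3 * (a\<^sup>2 * (2 + a\<^sup>2))"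
      unfolding mu c_def by (simp add: field_simps power2_eq_square power3_eq_cube)
    have d: "2 * (\<mu> / 3) * (a * c) = a / 3 * (\<mu> * (1 + a\<^sup>2))"
      unfolding c[symmetric] by simp
    show ?thesis unfolding n d using assms by simp
  qed
  have quot: "(\<lambda>\<beta>. N \<beta> / D \<beta> - a\<^sup>2 * (2 + a\<^sup>2) / (\<mu> * (1 + a\<^sup>2))) \<in> O[?F](?g)"
    using bigo_approx_divide[OF N D g] c0 assms unfolding lim by simp
  let ?K = "a\<^sup>2 * (2 + a\<^sup>2) / (\<mu> * (1 + a\<^sup>2))"
  have "(\<lambda>\<beta>. (N \<beta> / D \<beta> - ?K) * (1 / e \<beta>)) \<in> O[?F](\<lambda>\<beta>. ?g \<beta> * (1 / e \<beta>))"
    by (intro landau_o.big.mult quot) simp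
  \<comment> \<open>An equality of functions everywhere: where e is 0, so is 1 / e.\<close>
  also have "(\<lambda>\<beta>. ?g \<beta> * (1 / e \<beta>)) = e"
    by (auto simp: power2_eq_square)
  finally have "(\<lambda>\<beta>. (N \<beta> / D \<beta> - ?K) * (1 / e \<beta>)) \<in> O[?F](e)" .
  moreover have "eventually (\<lambda>\<beta>. (N \<beta> / D \<beta> - ?K) * (1 / e \<beta>)
      = V_S \<beta> (\<mu> / 3 * inv_lorentz \<beta> ^ 3) - ?K / inv_lorentz \<beta>) ?F"
    using ev
  proof eventually_elim
    case (elim b)
    have sy: "sin (y b) > 0" using elim by (intro sin_gt_zero) auto
    have e: "e b > 0" using elim by simp
    then have s: "sin (x b) = S b * e b" "sin (y b) = Y b * e b ^ 3"
      and c: "b * cos (x b) = 1 - C b * (e b)\<^sup>2"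
      using e by (auto simp: S_def Y_def C_def)
    have sc: "b * S b * cos (x b) = S b - S b * C b * (e b)\<^sup>2"
    proof -
      have "b * S b * cos (x b) = S b * (b * cos (x b))" by simp
      then show ?thesis unfolding c by (simp add: algebra_simps)
    qed
    have e2: "1 - b\<^sup>2 = (e b)\<^sup>2" using elim by simp
    have ab: "\<bar>sin (x b)\<bar> = S b * e b" "\<bar>sin (y b)\<bar> = Y b * e b ^ 3"
      using s elim sy by auto
    have nn: "(1 - b\<^sup>2) * (\<bar>sin (y b)\<bar> - \<bar>sin (x b)\<bar> + b * sin (x b) * cos (x b))
        + 2 * b\<^sup>2 * (sin (x b))\<^sup>2 * \<bar>sin (y b)\<bar> = e b ^ 5 * N b"
    proof -
      have "(1 - b\<^sup>2) * (\<bar>sin (y b)\<bar> - \<bar>sin (x b)\<bar> + b * sin (x b) * cos (x b))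
        + 2 * b\<^sup>2 * (sin (x b))\<^sup>2 * \<bar>sin (y b)\<bar>
        = (e b)\<^sup>2 * (Y b * e b ^ 3 - S b * e b + e b * (b * S b * cos (x b)))
        + 2 * b\<^sup>2 * (S b * e b)\<^sup>2 * (Y b * e b ^ 3)"
        unfolding e2 ab unfolding s by (simp add: algebra_simps)
      also have "\<dots> = e b ^ 5 * N b"
        unfolding sc N_def by (simp add: algebra_simps eval_nat_numeral)
      finally show ?thesis .
    qed
    have dd: "2 * \<bar>sin (y b)\<bar> * (\<bar>sin (x b)\<bar> - b * sin (x b) * cos (x b)) = e b ^ 6 * D b"
    proof -
      have "2 * \<bar>sin (y b)\<bar> * (\<bar>sin (x b)\<bar> - b * sin (x b) * cos (x b))
        = 2 * (Y b * e b ^ 3) * (S b * e b - e b * (b * S b * cos (x b)))"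
        unfolding ab unfolding s by (simp add: algebra_simps)
      also have "\<dots> = e b ^ 6 * D b"
        unfolding sc D_def by (simp add: algebra_simps eval_nat_numeral)
      finally show ?thesis .
    qed
    have "V_S b (y b) = e b ^ 5 * N b / (e b ^ 6 * D b)"
      unfolding V_S_def Let_def x_def[symmetric] nn dd ..
    also have "\<dots> = N b / D b * (1 / e b)"
      using e by (simp add: eval_nat_numeral)
    finally show ?case by (simp add: y_def e_def diff_divide_distrib)
  qed
  ultimately show ?thesis
    unfolding e_def by (rule landau_o.big.in_cong[THEN iffD1, rotated])
qed

theorem proposition4p1:
  fixes \<mu> :: real
  assumes "\<mu> \<noteq> 0"
  shows "(\<lambda>\<beta>. V_S \<beta> (\<mu> / (3 * lorentz \<beta> ^ 3)) - lorentz \<beta> * K_fs \<mu>)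
           \<in> O[at_left 1](\<lambda>\<beta>. if \<mu> > 0 then 1 / lorentz \<beta> else 1 / lorentz \<beta> ^ 3)"
proof (cases "\<mu> > 0")
  case True
  then obtain a where a: "a > 0" "3 * a + a ^ 3 = 2 * \<mu>"
    "K_fs \<mu> = a\<^sup>2 * (2 + a\<^sup>2) / (\<mu> * (1 + a\<^sup>2))" by (rule K_fs_algebraic)
  have "(\<lambda>\<beta>. V_S \<beta> (\<mu> / 3 * inv_lorentz \<beta> ^ 3) - K_fs \<mu> / inv_lorentz \<beta>) \<in> O[at_left 1](inv_lorentz)"
    unfolding a(3) using True a(1,2) by (rule V_S_pos_bigo)
  \<comment> \<open>\<open>lorentz\<close> is the reciprocal of \<open>inv_lorentz\<close> only for
    \<beta> in (0, 1), which holds eventually at the left of 1.\<close>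
  also have "?this \<longleftrightarrow> ?thesis"
    by (intro landau_o.big.cong_ex eventually_mono[OF eventually_at_left_1_unit])
       (auto simp: True lorentz_eq power_one_over)
  finally show ?thesis .
next
  case False
  with assms have neg: "\<mu> < 0" by simp
  then have "- \<mu> / 3 > 0" by simp
  \<comment> \<open>Here \<open>K_fs\<close> vanishes, so the potential itself is the error
    term.\<close>
  then have "(\<lambda>\<beta>. V_S \<beta> (- (- \<mu> / 3 * inv_lorentz \<beta> ^ 3))) \<in> O[at_left 1](\<lambda>\<beta>. inv_lorentz \<beta> ^ 3)"
    by (rule V_S_neg_bigo)
  also have "?this \<longleftrightarrow> ?thesis"
    by (intro landau_o.big.cong_ex eventually_mono[OF eventually_at_left_1_unit])
       (use neg in \<open>auto simp: K_fs_def lorentz_eq power_one_over\<close>)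
  finally show ?thesis .
qed

end
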